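(* Any holomorphic function $f(z)$ may be interpreted as a geodesic in the space $\Lambda$ of analytic curves, in the sense that, for $c$ a real constant, $w(t,x)=f(x+ict)$ solves the system $$\mathrm{Im}\left[\bar w_x\left(|w_x|^2w_{tt}+|w_t|^2w_{xx}\right)\right]=0,\qquad w_t\bar w_x+\bar w_tw_x=0.$$
   Context: Subscripts denote partial derivatives, $\bar w$ is the complex conjugate of $w$, and $t,x$ are real with $x+ict$ in the domain of $f$. The displayed system is the geodesic equation on the (formal) space $\Lambda$ of unparametrized analytic curves for a parametrized family $w(t,x)$ of curves in normal motion. *)

theory Defs
  imports "HOL-Complex_Analysis.Complex_Analysis"
begin

text \<open>
  A family \<open>w t x\<close> of parametrized plane curves: \<open>t\<close> is time, \<open>x\<close> the curve parameter.
  Partial derivatives are taken in the real sense and are only meaningful where they exist,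
  which is why existence is part of \<open>C2_family_on\<close> below.
\<close>

definition partial_t :: "(real \<Rightarrow> real \<Rightarrow> complex) \<Rightarrow> real \<Rightarrow> real \<Rightarrow> complex" where
  "partial_t w t x = vector_derivative (\<lambda>s. w s x) (at t)"

definition partial_x :: "(real \<Rightarrow> real \<Rightarrow> complex) \<Rightarrow> real \<Rightarrow> real \<Rightarrow> complex" where
  "partial_x w t x = vector_derivative (\<lambda>y. w t y) (at x)"

definition partially_differentiable_on :: "(real \<times> real) set \<Rightarrow> (real \<Rightarrow> real \<Rightarrow> complex) \<Rightarrow> bool" where
  "partially_differentiable_on D w \<longleftrightarrow>
     (\<forall>(t, x) \<in> D. (\<lambda>s. w s x) differentiable (at t) \<and> (\<lambda>y. w t y) differentiable (at x))"

definition C1_family_on :: "(real \<times> real) set \<Rightarrow> (real \<Rightarrow> real \<Rightarrow> complex) \<Rightarrow> bool" where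
  "C1_family_on D w \<longleftrightarrow>
     partially_differentiable_on D w \<and>
     continuous_on D (\<lambda>(t, x). partial_t w t x) \<and>
     continuous_on D (\<lambda>(t, x). partial_x w t x)"

definition C2_family_on :: "(real \<times> real) set \<Rightarrow> (real \<Rightarrow> real \<Rightarrow> complex) \<Rightarrow> bool" where
  "C2_family_on D w \<longleftrightarrow>
     C1_family_on D w \<and> C1_family_on D (partial_t w) \<and> C1_family_on D (partial_x w)"

text \<open>
  Classical solutions, on an open set \<open>D\<close> of pairs \<open>(t, x)\<close>, of the geodesic equation on
  unparametrized curves (first equation) for a family in normal motion (second equation).
  Points with \<open>w\<^sub>x = 0\<close> are not excluded.
\<close>

definition solves_geodesic_system :: "(real \<times> real) set \<Rightarrow> (real \<Rightarrow> real \<Rightarrow> complex) \<Rightarrow> bool" where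
  "solves_geodesic_system D w \<longleftrightarrow>
     C2_family_on D w \<and>
     (\<forall>(t, x) \<in> D.
        let w_t = partial_t w t x;
            w_x = partial_x w t x;
            w_tt = partial_t (partial_t w) t x;
            w_xx = partial_x (partial_x w) t x
        in Im (cnj w_x * (of_real ((cmod w_x)\<^sup>2) * w_tt + of_real ((cmod w_t)\<^sup>2) * w_xx)) = 0 \<and>
           w_t * cnj w_x + cnj w_t * w_x = 0)"

end

theory Submission imports Defs begin

text \<open>
  With \<open>z = x + \<i>ct\<close>, differentiating in \<open>x\<close> is differentiating in \<open>z\<close>, and
  differentiating in \<open>t\<close> multiplies in addition by \<open>\<i>c\<close>. Hence \<open>w\<^sub>t = \<i>c w\<^sub>x\<close>, so that
  \<open>w\<^sub>t cnj w\<^sub>x\<close> is purely imaginary, and \<open>w\<^sub>t\<^sub>t = -c\<^sup>2 w\<^sub>x\<^sub>x\<close> while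
  \<open>cmod w\<^sub>t ^ 2 = c\<^sup>2 cmod w\<^sub>x ^ 2\<close>, so that the bracket in the geodesic equation vanishes.
\<close>

context
  fixes S :: "complex set" and c :: real
  assumes opS: "open S"
begin

private definition pt :: "real \<Rightarrow> real \<Rightarrow> complex" where
  "pt t x = of_real x + \<i> * of_real c * of_real t"

private definition dom :: "(real \<times> real) set" where
  "dom = {(t, x). pt t x \<in> S}"

lemma continuous_on_pt: "continuous_on A (\<lambda>(t, x). pt t x)"
  unfolding pt_def split_def by (intro continuous_intros)

text \<open>
  Agreement with \<open>h\<close> is only required on the domain, because \<open>partial_t\<close> and \<open>partial_x\<close>
  have junk values outside; openness of \<open>S\<close> makes this enough to differentiate again.
\<close>

lemma has_vector_derivative_along_pt:
  assumes "h holomorphic_on S" and eq: "\<And>t x. pt t x \<in> S \<Longrightarrow> w t x = h (pt t x)"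
    and z: "pt t x \<in> S"
  shows "((\<lambda>s. w s x) has_vector_derivative \<i> * of_real c * deriv h (pt t x)) (at t)"
    and "((\<lambda>y. w t y) has_vector_derivative deriv h (pt t x)) (at x)"
proof -
  have d: "(h has_field_derivative deriv h (pt t x)) (at (pt t x))"
    using assms opS holomorphic_derivI by blast
  have "((\<lambda>s. pt s x) has_vector_derivative \<i> * of_real c) (at t)"
    unfolding pt_def by (auto intro!: derivative_eq_intros)
  from field_vector_diff_chain_at[OF this d]
  have dt: "((\<lambda>s. h (pt s x)) has_vector_derivative \<i> * of_real c * deriv h (pt t x)) (at t)"
    by (simp add: o_def)
  have "((\<lambda>y. pt t y) has_vector_derivative 1) (at x)"
    unfolding pt_def by (auto intro!: derivative_eq_intros)
  from field_vector_diff_chain_at[OF this d]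
  have dx: "((\<lambda>y. h (pt t y)) has_vector_derivative deriv h (pt t x)) (at x)"
    by (simp add: o_def)
  have ot: "open ((\<lambda>s. pt s x) -` S)" and ox: "open ((\<lambda>y. pt t y) -` S)"
    unfolding pt_def by (intro open_vimage opS continuous_intros)+
  show "((\<lambda>s. w s x) has_vector_derivative \<i> * of_real c * deriv h (pt t x)) (at t)"
    by (rule has_vector_derivative_transform_within_open[OF dt ot]) (use z eq in auto)
  show "((\<lambda>y. w t y) has_vector_derivative deriv h (pt t x)) (at x)"
    by (rule has_vector_derivative_transform_within_open[OF dx ox]) (use z eq in auto)
qed

text \<open>Leaving \<open>w\<close> and \<open>h\<close> general allows iteration: on the domain
  the partials of \<open>w\<close> are again holomorphic functions composed with \<open>pt\<close>,
  so second partials come from a further application.\<close>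

lemma partials_along_pt:
  assumes "h holomorphic_on S" "\<And>t x. pt t x \<in> S \<Longrightarrow> w t x = h (pt t x)" "pt t x \<in> S"
  shows "partial_t w t x = \<i> * of_real c * deriv h (pt t x)"
    and "partial_x w t x = deriv h (pt t x)"
  unfolding partial_t_def partial_x_def
  using has_vector_derivative_along_pt[of h w, OF assms] vector_derivative_at by blast+

text \<open>Both partials are constant multiples of \<open>deriv h\<close> along \<open>pt\<close>,
  and \<open>deriv h\<close> is itself holomorphic, hence continuous. Instances with
  \<open>h\<close> equal to f, icf' and f' together give the C2 property.\<close>

lemma C1_family_along_pt:
  assumes h: "h holomorphic_on S" and eq: "\<And>t x. pt t x \<in> S \<Longrightarrow> w t x = h (pt t x)"
  shows "C1_family_on dom w"
proof -
  have "continuous_on S (deriv h)"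
    using h opS by (intro holomorphic_on_imp_continuous_on holomorphic_deriv)
  then have cont: "continuous_on dom (\<lambda>p. deriv h (case p of (t, x) \<Rightarrow> pt t x))"
    by (rule continuous_on_compose2[OF _ continuous_on_pt]) (auto simp: dom_def)
  have "continuous_on dom (\<lambda>(t, x). partial_t w t x) \<longleftrightarrow>
      continuous_on dom (\<lambda>p. \<i> * of_real c * deriv h (case p of (t, x) \<Rightarrow> pt t x))"
    by (rule continuous_on_cong) (auto simp: dom_def partials_along_pt[of h w, OF h eq])
  moreover have "continuous_on dom (\<lambda>(t, x). partial_x w t x) \<longleftrightarrow>
      continuous_on dom (\<lambda>p. deriv h (case p of (t, x) \<Rightarrow> pt t x))"
    by (rule continuous_on_cong) (auto simp: dom_def partials_along_pt[of h w, OF h eq])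
  moreover have "partially_differentiable_on dom w"
    unfolding partially_differentiable_on_def dom_def
    using has_vector_derivative_along_pt[of h w, OF h eq] differentiableI_vector by blast
  ultimately show ?thesis
    unfolding C1_family_on_def using cont by (auto intro!: continuous_intros)
qed

lemma solves_geodesic_system_along_pt:
  assumes f: "f holomorphic_on S"
  shows "solves_geodesic_system dom (\<lambda>t x. f (pt t x))"
proof -
  let ?w = "\<lambda>t x. f (pt t x)" and ?ic = "\<i> * of_real c"
  have hx: "deriv f holomorphic_on S"
    using f opS by (rule holomorphic_deriv)
  \<comment> \<open>icf' is the holomorphic function that represents the first t-derivative.\<close>
  then have ht: "(\<lambda>z. ?ic * deriv f z) holomorphic_on S"
    by (intro holomorphic_on_mult holomorphic_on_const)
  have wt: "partial_t ?w t x = ?ic * deriv f (pt t x)"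
    and wx: "partial_x ?w t x = deriv f (pt t x)" if "pt t x \<in> S" for t x
    using partials_along_pt[of f ?w, OF f refl that] .
  have wxx: "partial_x (partial_x ?w) t x = deriv (deriv f) (pt t x)" if "pt t x \<in> S" for t x
    using partials_along_pt(2)[of _ "partial_x ?w", OF hx wx that] .
  have wtt: "partial_t (partial_t ?w) t x = - (of_real c)\<^sup>2 * deriv (deriv f) (pt t x)"
    if z: "pt t x \<in> S" for t x
  proof -
    have "deriv (\<lambda>z. ?ic * deriv f z) (pt t x) = ?ic * deriv (deriv f) (pt t x)"
      by (intro deriv_cmult holomorphic_on_imp_differentiable_at[OF hx opS z])
    with partials_along_pt(1)[of _ "partial_t ?w", OF ht wt z] show ?thesis
      by (simp add: power2_eq_square algebra_simps)
  qed
  have "C2_family_on dom ?w"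
    unfolding C2_family_on_def
    using C1_family_along_pt[OF f refl] C1_family_along_pt[OF ht wt] C1_family_along_pt[OF hx wx]
    by blast
  \<comment> \<open>With u = f'(z) the two summands are ic|u|^2 and its conjugate -ic|u|^2.\<close>
  moreover have "?ic * u * cnj u + cnj (?ic * u) * u = 0" for u
    by (simp add: algebra_simps)
  ultimately show ?thesis
    unfolding solves_geodesic_system_def Let_def
    by (auto simp: dom_def wt wx wtt wxx norm_mult power_mult_distrib)
qed

text \<open>Unfolding removes the private constants, so that the result can be stated outside the
  context.\<close>

lemmas solves_geodesic_system_holomorphic =
  solves_geodesic_system_along_pt[unfolded dom_def pt_def]

end

theorem corollary19:
  fixes f :: "complex \<Rightarrow> complex" and S :: "complex set" and c :: real
  assumes "open S" and "f holomorphic_on S"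
  shows "solves_geodesic_system
           {(t, x). of_real x + \<i> * of_real c * of_real t \<in> S}
           (\<lambda>t x. f (of_real x + \<i> * of_real c * of_real t))"
  using assms by (rule solves_geodesic_system_holomorphic)

end
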